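(* Let $Q\in\mathcal{S}^n$, let $G_Q$ be its convexity graph, and let $\mathfrak{C}$ be the collection of all maximal cliques of $G_Q$. Then $$\min_{C\in\mathfrak{C}}\ell(Q_{CC})=\nu(Q)$$ if and only if there exists $C^*\in\mathfrak{C}$ such that $$Q_{C^*C^*}\in\mathcal{Q}^{|C^*|}\quad\text{and}\quad\min_{C\in\mathfrak{C}}\ell(Q_{CC})=\ell(Q_{C^*C^*}).$$
   Context: $\mathcal{S}^m$ is the space of real symmetric $m\times m$ matrices, with trace inner product $\langle U,V\rangle=\sum_{i,j}U_{ij}V_{ij}$; $e$ is the all-ones vector, $E=ee^T$; $\Delta_m=\{x\in\mathbb{R}^m: e^Tx=1,\ x\ge 0\}$. $\mathcal{DN}^m$ is the cone of matrices in $\mathcal{S}^m$ that are both positive semidefinite and entrywise nonnegative. For any $m$ and $M\in\mathcal{S}^m$: $\nu(M)=\min\{x^TMx: x\in\Delta_m\}$ and $\ell(M)=\min\{\langle M,X\rangle:\langle E,X\rangle=1,\ X\in\mathcal{DN}^m\}$. $\mathcal{Q}^m=\{M\in\mathcal{S}^m:\ell(M)=\nu(M)\}$. The convexity graph of $Q\in\mathcal{S}^n$ is the simple undirected graph $G_Q=(V_Q,E_Q)$ with $V_Q=\{1,\dots,n\}$ and $E_Q=\{(i,j):1\le i<j\le n,\ 2Q_{ij}<Q_{ii}+Q_{jj}\}$. A clique is a set of mutually adjacent vertices (single vertices are cliques); it is maximal if it is not a proper subset of another clique. $Q_{CC}\in\mathcal{S}^{|C|}$ denotes the principal submatrix of $Q$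 with rows and columns indexed by $C$. *)

theory Defs
  imports
    "HOL-Library.Ramsey"
    "HOL-Analysis.Function_Topology"
    "Jordan_Normal_Form.DL_Submatrix"
begin

text \<open>Matrix rows, matrix columns and graph vertices are indexed from 0 rather than from 1.\<close>

definition sym_mats :: "nat \<Rightarrow> real mat set" where
  "sym_mats m = {M \<in> carrier_mat m m. transpose_mat M = M}"

definition trace_inner :: "real mat \<Rightarrow> real mat \<Rightarrow> real" where
  "trace_inner U V = (\<Sum>i<dim_row U. \<Sum>j<dim_col U. U $$ (i, j) * V $$ (i, j))"

definition ones_vec :: "nat \<Rightarrow> real vec" where
  "ones_vec m = vec m (\<lambda>_. 1)"

definition ones_mat :: "nat \<Rightarrow> real mat" where
  "ones_mat m = mat m m (\<lambda>_. 1)"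

definition std_simplex :: "nat \<Rightarrow> real vec set" where
  "std_simplex m = {x \<in> carrier_vec m. ones_vec m \<bullet> x = 1 \<and> 0\<^sub>v m \<le> x}"

definition psd_mat :: "nat \<Rightarrow> real mat \<Rightarrow> bool" where
  "psd_mat m M \<longleftrightarrow> M \<in> sym_mats m \<and> (\<forall>v \<in> carrier_vec m. 0 \<le> v \<bullet> (M *\<^sub>v v))"

definition dnn_cone :: "nat \<Rightarrow> real mat set" where
  "dnn_cone m = {M. psd_mat m M \<and> 0\<^sub>m m m \<le> M}"

text \<open>The order of the (square) matrix is read off from its number of rows. Both infima below
  are minima whenever that order is positive: see \<open>nu_attained\<close> and \<open>ell_attained\<close>.\<close>

definition nu :: "real mat \<Rightarrow> real" where
  "nu M = (INF x \<in> std_simplex (dim_row M). x \<bullet> (M *\<^sub>v x))"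

definition dnn_feasible :: "nat \<Rightarrow> real mat set" where
  "dnn_feasible m = {X \<in> dnn_cone m. trace_inner (ones_mat m) X = 1}"

definition ell :: "real mat \<Rightarrow> real" where
  "ell M = (INF X \<in> dnn_feasible (dim_row M). trace_inner M X)"

definition exact_mats :: "nat \<Rightarrow> real mat set" where
  "exact_mats m = {M \<in> sym_mats m. ell M = nu M}"

definition convexity_vertices :: "real mat \<Rightarrow> nat set" where
  "convexity_vertices Q = {..<dim_row Q}"

definition convexity_edges :: "real mat \<Rightarrow> nat set set" where
  "convexity_edges Q =
     {{i, j} | i j. i < j \<and> j < dim_row Q \<and> 2 * Q $$ (i, j) < Q $$ (i, i) + Q $$ (j, j)}"

text \<open>The predicate \<open>clique\<close> also accepts the empty set, which is never maximal when the graph has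
  a vertex.\<close>

definition convexity_cliques :: "real mat \<Rightarrow> nat set set" where
  "convexity_cliques Q = {C. C \<subseteq> convexity_vertices Q \<and> clique C (convexity_edges Q)}"

definition maximal_cliques :: "real mat \<Rightarrow> nat set set" where
  "maximal_cliques Q = {C \<in> convexity_cliques Q. \<not> (\<exists>D \<in> convexity_cliques Q. C \<subset> D)}"

abbreviation principal_submatrix :: "real mat \<Rightarrow> nat set \<Rightarrow> real mat" where
  "principal_submatrix Q C \<equiv> submatrix Q C C"


lemma attains_min_on_cube:
  fixes h :: "('a \<Rightarrow> real) \<Rightarrow> real"
  assumes "closed S" "S \<noteq> {}" "\<And>f i. f \<in> S \<Longrightarrow> f i \<in> {0..1}" "continuous_on UNIV h"
  shows "\<exists>f\<in>S. \<forall>g\<in>S. h f \<le> h g"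
proof -
  have "compactin (product_topology (\<lambda>_. euclidean) UNIV)
      (PiE (UNIV :: 'a set) (\<lambda>_. {0..1::real}))"
    unfolding compactin_PiE by simp
  then have "compact (PiE (UNIV :: 'a set) (\<lambda>_. {0..1::real}))"
    by (simp add: euclidean_product_topology)
  moreover have "S = PiE UNIV (\<lambda>_. {0..1}) \<inter> S"
    using assms(3) by (auto simp: PiE_def Pi_def)
  ultimately have "compact S"
    using assms(1) by (metis compact_Int_closed)
  then show ?thesis
    using continuous_attains_inf[of S h] assms(2,4) continuous_on_subset by blast
qed

lemma nu_attained:
  assumes "dim_row M > 0" "M \<in> sym_mats (dim_row M)"
  shows "\<exists>x \<in> std_simplex (dim_row M). x \<bullet> (M *\<^sub>v x) = nu M \<and>
    (\<forall>y \<in> std_simplex (dim_row M). nu M \<le> y \<bullet> (M *\<^sub>v y))"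
proof -
  define m where "m = dim_row M"
  have m: "m > 0" and M: "M \<in> carrier_mat m m"
    using assms by (auto simp: m_def sym_mats_def)
  define S where "S = {f :: nat \<Rightarrow> real. (\<forall>i. 0 \<le> f i) \<and> (\<forall>i\<in>{m..}. f i = 0) \<and> (\<Sum>i<m. f i) = 1}"
  define h where "h f = (\<Sum>i<m. f i * (\<Sum>j<m. M $$ (i, j) * f j))" for f :: "nat \<Rightarrow> real"
  have h: "vec m f \<bullet> (M *\<^sub>v vec m f) = h f" for f
    using M by (auto simp: h_def scalar_prod_def lessThan_atLeast0 intro!: sum.cong)
  have "closed S"
    unfolding S_def Ball_def
    by (intro closed_Collect_conj closed_Collect_all closed_Collect_imp closed_Collect_le
        closed_Collect_eq open_Collect_const continuous_intros continuous_on_product_coordinates)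
  moreover have "(\<lambda>i. if i = 0 then 1 else 0) \<in> S"
    using m by (auto simp: S_def sum.delta)
  then have "S \<noteq> {}" by blast
  moreover have "f i \<in> {0..1}" if "f \<in> S" for f i
  proof (cases "i < m")
    case True
    then have "f i \<le> (\<Sum>i<m. f i)"
      using that by (intro member_le_sum) (auto simp: S_def)
    then show ?thesis using that by (auto simp: S_def)
  qed (use that in \<open>auto simp: S_def\<close>)
  moreover have "continuous_on UNIV h"
    unfolding h_def by (intro continuous_intros continuous_on_product_coordinates)
  ultimately obtain f where f: "f \<in> S" "\<And>g. g \<in> S \<Longrightarrow> h f \<le> h g"
    using attains_min_on_cube[of S h] by blast
  have 1: "vec m f \<in> std_simplex m"
    using f(1) by (auto simp: S_def std_simplex_def ones_vec_def scalar_prod_def less_eq_vec_def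
        lessThan_atLeast0)
  have 2: "vec m f \<bullet> (M *\<^sub>v vec m f) \<le> y \<bullet> (M *\<^sub>v y)" if y: "y \<in> std_simplex m" for y
  proof -
    define g where "g i = (if i < m then y $ i else 0)" for i
    have "g \<in> S"
      using y by (auto simp: S_def std_simplex_def ones_vec_def scalar_prod_def less_eq_vec_def
        lessThan_atLeast0 g_def)
    moreover have "y = vec m g"
      using y by (auto simp: std_simplex_def g_def)
    ultimately show ?thesis using f(2) h by metis
  qed
  have "nu M = vec m f \<bullet> (M *\<^sub>v vec m f)"
    unfolding nu_def m_def[symmetric] using 1 2 by (intro cInf_eq_minimum) auto
  then show ?thesis using 1 2 unfolding m_def[symmetric] by metis
qed

lemma ell_attained:
  assumes "dim_row M > 0" "M \<in> sym_mats (dim_row M)"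
  shows "\<exists>X \<in> dnn_feasible (dim_row M). trace_inner M X = ell M \<and>
    (\<forall>Y \<in> dnn_feasible (dim_row M). ell M \<le> trace_inner M Y)"
proof -
  define m where "m = dim_row M"
  have m: "m > 0" and M: "M \<in> carrier_mat m m"
    using assms by (auto simp: m_def sym_mats_def)
  define S where "S = {f :: nat \<times> nat \<Rightarrow> real. (\<forall>p. 0 \<le> f p) \<and>
    (\<forall>p\<in>- ({..<m} \<times> {..<m}). f p = 0) \<and> (\<forall>i j. f (i, j) = f (j, i)) \<and>
    (\<forall>v. 0 \<le> (\<Sum>i<m. v i * (\<Sum>j<m. f (i, j) * v j))) \<and> (\<Sum>i<m. \<Sum>j<m. f (i, j)) = 1}"
  define h where "h f = (\<Sum>i<m. \<Sum>j<m. M $$ (i, j) * f (i, j))" for f :: "nat \<times> nat \<Rightarrow> real"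
  have h: "trace_inner M (mat m m f) = h f" for f
    using M by (auto simp: h_def trace_inner_def intro!: sum.cong)
  have quad: "vec m v \<bullet> (mat m m f *\<^sub>v vec m v) = (\<Sum>i<m. v i * (\<Sum>j<m. f (i, j) * v j))"
    for f :: "nat \<times> nat \<Rightarrow> real" and v
    by (auto simp: scalar_prod_def lessThan_atLeast0 intro!: sum.cong)
  have feas: "mat m m f \<in> dnn_feasible m \<longleftrightarrow> f \<in> S"
    if "\<forall>p\<in>- ({..<m} \<times> {..<m}). f p = 0" for f
  proof -
    have nonneg: "0\<^sub>m m m \<le> mat m m f \<longleftrightarrow> (\<forall>p. 0 \<le> f p)"
    proof
      assume le: "0\<^sub>m m m \<le> mat m m f"
      show "\<forall>p. 0 \<le> f p"
      proof
        fix p show "0 \<le> f p"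
          using le that by (cases p; cases "p \<in> {..<m} \<times> {..<m}") (auto simp: less_eq_mat_def)
      qed
    qed (auto simp: less_eq_mat_def)
    have sym: "mat m m f \<in> sym_mats m \<longleftrightarrow> (\<forall>i j. f (i, j) = f (j, i))"
    proof
      assume "mat m m f \<in> sym_mats m"
      then have tr: "transpose_mat (mat m m f) = mat m m f" by (simp add: sym_mats_def)
      show "\<forall>i j. f (i, j) = f (j, i)"
      proof (intro allI)
        fix i j
        show "f (i, j) = f (j, i)"
        proof (cases "i < m \<and> j < m")
          case True
          then have "transpose_mat (mat m m f) $$ (j, i) = f (i, j)" by simp
          then show ?thesis using True by (simp add: tr)
        qed (use that in auto)
      qed
    qed (auto simp: sym_mats_def intro!: eq_matI)
    have psd: "(\<forall>v \<in> carrier_vec m. 0 \<le> v \<bullet> (mat m m f *\<^sub>v v)) \<longleftrightarrow>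
        (\<forall>v. 0 \<le> (\<Sum>i<m. v i * (\<Sum>j<m. f (i, j) * v j)))"
    proof
      assume R: "\<forall>v. 0 \<le> (\<Sum>i<m. v i * (\<Sum>j<m. f (i, j) * v j))"
      show "\<forall>v \<in> carrier_vec m. 0 \<le> v \<bullet> (mat m m f *\<^sub>v v)"
      proof
        fix v :: "real vec" assume "v \<in> carrier_vec m"
        then have "v = vec m (\<lambda>i. v $ i)" by auto
        then show "0 \<le> v \<bullet> (mat m m f *\<^sub>v v)" using R quad by metis
      qed
    qed (metis quad vec_carrier)
    have one: "trace_inner (ones_mat m) (mat m m f) = (\<Sum>i<m. \<Sum>j<m. f (i, j))"
      by (auto simp: trace_inner_def ones_mat_def intro!: sum.cong)
    show ?thesis
      unfolding dnn_feasible_def dnn_cone_def psd_mat_def S_def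
      using that by (auto simp: nonneg sym psd one)
  qed
  have S0: "\<forall>p\<in>- ({..<m} \<times> {..<m}). f p = 0" if "f \<in> S" for f
    using that by (simp add: S_def)
  have "closed S"
    unfolding S_def Ball_def
    by (intro closed_Collect_conj closed_Collect_all closed_Collect_imp closed_Collect_le
        closed_Collect_eq open_Collect_const continuous_intros continuous_on_product_coordinates)
  moreover have "(\<lambda>p. if p = (0, 0) then 1 else 0) \<in> S"
  proof -
    have "(\<Sum>j<m. (if (i, j) = (0, 0) then 1 else 0) * v j) = (if i = 0 then v 0 else (0::real))"
      for i :: nat and v :: "nat \<Rightarrow> real"
    proof -
      have "(\<Sum>j<m. (if (i, j) = (0, 0) then 1 else 0) * v j)
          = (\<Sum>j<m. if j = 0 then (if i = 0 then v 0 else 0) else 0)"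
        by (intro sum.cong) auto
      then show ?thesis using m by simp
    qed
    note inner = this
    have "(\<Sum>i<m. v i * (\<Sum>j<m. (if (i, j) = (0, 0) then 1 else 0) * v j)) = v 0 * v 0"
      for v :: "nat \<Rightarrow> real"
    proof -
      have "(\<Sum>i<m. v i * (\<Sum>j<m. (if (i, j) = (0, 0) then 1 else 0) * v j))
          = (\<Sum>i<m. if i = 0 then v 0 * v 0 else 0)"
        unfolding inner by (intro sum.cong) auto
      then show ?thesis using m by simp
    qed
    moreover have "(\<Sum>i<m. \<Sum>j<m. (if (i, j) = (0, 0) then 1 else (0::real))) = 1"
      using inner[of _ "\<lambda>_. 1"] m by simp
    ultimately show ?thesis using m unfolding S_def by auto
  qed
  then have "S \<noteq> {}" by blast
  moreover have "f p \<in> {0..1}" if "f \<in> S" for f p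
  proof (cases "p \<in> {..<m} \<times> {..<m}")
    case True
    then have "f p \<le> sum f ({..<m} \<times> {..<m})"
      using that by (intro member_le_sum) (auto simp: S_def)
    also have "\<dots> = 1"
      using that by (simp add: S_def sum.cartesian_product)
    finally show ?thesis using that by (cases p) (auto simp: S_def)
  next
    case False
    then show ?thesis using S0[OF that] by simp
  qed
  moreover have "continuous_on UNIV h"
    unfolding h_def by (intro continuous_intros continuous_on_product_coordinates)
  ultimately obtain f where f: "f \<in> S" "\<And>g. g \<in> S \<Longrightarrow> h f \<le> h g"
    using attains_min_on_cube[of S h] by blast
  have 1: "mat m m f \<in> dnn_feasible m"
    using feas[OF S0[OF f(1)]] f(1) by simp
  have 2: "trace_inner M (mat m m f) \<le> trace_inner M Y" if Y: "Y \<in> dnn_feasible m" for Y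
  proof -
    define g where "g p = (if p \<in> {..<m} \<times> {..<m} then Y $$ p else 0)" for p
    have "Y \<in> carrier_mat m m"
      using Y by (auto simp: dnn_feasible_def dnn_cone_def psd_mat_def sym_mats_def)
    then have Yg: "Y = mat m m g"
      by (auto simp: g_def)
    have "g \<in> S"
      using feas[of g] Y Yg by (simp add: g_def)
    then show ?thesis using f(2) h Yg by metis
  qed
  have "ell M = trace_inner M (mat m m f)"
    unfolding ell_def m_def[symmetric] using 1 2 by (intro cInf_eq_minimum) auto
  then show ?thesis using 1 2 unfolding m_def[symmetric] by metis
qed

lemma finite_maximal_cliques: "finite (maximal_cliques Q)"
  by (rule finite_subset[of _ "Pow {..<dim_row Q}"])
    (auto simp: maximal_cliques_def convexity_cliques_def convexity_vertices_def)

lemma maximal_cliques_nonempty: "maximal_cliques Q \<noteq> {}"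
proof -
  have fin: "finite (convexity_cliques Q)"
    by (rule finite_subset[of _ "Pow {..<dim_row Q}"])
      (auto simp: convexity_cliques_def convexity_vertices_def)
  have "{} \<in> convexity_cliques Q" by (simp add: convexity_cliques_def)
  then obtain C where "C \<in> convexity_cliques Q" "\<forall>D \<in> convexity_cliques Q. C \<subseteq> D \<longrightarrow> C = D"
    using finite_has_maximal[OF fin] by blast
  then show ?thesis unfolding maximal_cliques_def by blast
qed

end

theory Submission
  imports Defs
begin

text \<open>
  The equivalence rests on a single fact: some maximal clique \<open>C\<close> of the convexity graph satisfies
  \<open>\<nu>(Q\<^sub>C\<^sub>C) = \<nu>(Q)\<close> (\<open>exists_maximal_clique_nu_eq\<close>). Together with the relaxation
  inequality \<open>\<ell>(M) \<le> \<nu>(M)\<close> (\<open>ell_le_nu\<close>) it shows that the minimum of \<open>\<ell>(Q\<^sub>D\<^sub>D)\<close> over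
  the maximal cliques \<open>D\<close> is at most \<open>\<ell>(Q\<^sub>C\<^sub>C) \<le> \<nu>(Q)\<close>. If that minimum equals \<open>\<nu>(Q)\<close>,
  then \<open>\<ell>(Q\<^sub>C\<^sub>C) = \<nu>(Q) = \<nu>(Q\<^sub>C\<^sub>C)\<close>, so \<open>C\<close> itself is the clique asked for. Conversely, if the
  minimum is \<open>\<ell>(Q\<^sub>D\<^sub>D)\<close> with \<open>Q\<^sub>D\<^sub>D\<close> exact, then it equals \<open>\<nu>(Q\<^sub>D\<^sub>D)\<close>, which is at least
  \<open>\<nu>(Q)\<close> (\<open>nu_le_nu_principal_submatrix\<close>).

  The clique \<open>C\<close> comes from a minimizer over the simplex. If two vertices \<open>i\<close>, \<open>j\<close> of its
  support are not adjacent, then \<open>Q\<^sub>i\<^sub>i + Q\<^sub>j\<^sub>j - 2 Q\<^sub>i\<^sub>j \<le> 0\<close>, that is, the quadratic form is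
  concave along \<open>e\<^sub>i - e\<^sub>j\<close>; moving all the weight of one of the two vertices to the other, in
  the direction in which the form does not increase to first order, keeps its value from
  increasing and shrinks the support. Repeating this ends at a minimizer whose support is a
  clique (\<open>exists_strictly_convex_support\<close>), and any maximal clique containing that support works.
\<close>

section \<open>Quadratic forms on probability weights\<close>

definition bilinear_form :: "'a set \<Rightarrow> ('a \<Rightarrow> 'a \<Rightarrow> real) \<Rightarrow> ('a \<Rightarrow> real) \<Rightarrow> ('a \<Rightarrow> real) \<Rightarrow> real" where
  "bilinear_form S A f g = (\<Sum>i\<in>S. \<Sum>j\<in>S. f i * A i j * g j)"

definition prob_weights :: "'a set \<Rightarrow> ('a \<Rightarrow> real) set" where
  "prob_weights S = {f. (\<forall>i\<in>S. 0 \<le> f i) \<and> sum f S = 1}"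

definition support :: "'a set \<Rightarrow> ('a \<Rightarrow> real) \<Rightarrow> 'a set" where
  "support S f = {i \<in> S. f i \<noteq> 0}"

lemma bilinear_form_sym:
  assumes "\<And>i j. i \<in> S \<Longrightarrow> j \<in> S \<Longrightarrow> A i j = A j i"
  shows "bilinear_form S A f g = bilinear_form S A g f"
proof -
  have "bilinear_form S A f g = (\<Sum>j\<in>S. \<Sum>i\<in>S. f i * A i j * g j)"
    unfolding bilinear_form_def by (rule sum.swap)
  also have "\<dots> = bilinear_form S A g f"
    unfolding bilinear_form_def using assms by (intro sum.cong) auto
  finally show ?thesis .
qed

lemma bilinear_form_add_scale:
  assumes "\<And>i j. i \<in> S \<Longrightarrow> j \<in> S \<Longrightarrow> A i j = A j i"
  shows "bilinear_form S A (\<lambda>k. f k + t * d k) (\<lambda>k. f k + t * d k)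
    = bilinear_form S A f f + 2 * t * bilinear_form S A d f + t\<^sup>2 * bilinear_form S A d d"
proof -
  have "bilinear_form S A (\<lambda>k. f k + t * d k) (\<lambda>k. f k + t * d k)
      = bilinear_form S A f f + t * bilinear_form S A d f + t * bilinear_form S A f d + t\<^sup>2 * bilinear_form S A d d"
    unfolding bilinear_form_def
    by (simp add: algebra_simps sum.distrib sum_distrib_left power2_eq_square)
  then show ?thesis using bilinear_form_sym[where A = A, OF assms, of S f d] by simp
qed

lemma bilinear_form_unit_difference:
  assumes "finite S" "i \<in> S" "j \<in> S"
  shows "bilinear_form S A (\<lambda>k. of_bool (k = i) - of_bool (k = j)) g
    = (\<Sum>l\<in>S. A i l * g l) - (\<Sum>l\<in>S. A j l * g l)"
proof -
  have "bilinear_form S A (\<lambda>k. of_bool (k = i) - of_bool (k = j)) g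
      = (\<Sum>k\<in>S. (if k = i then \<Sum>l\<in>S. A i l * g l else 0) - (if k = j then \<Sum>l\<in>S. A j l * g l else 0))"
    unfolding bilinear_form_def by (intro sum.cong) (auto simp: sum_negf)
  also have "\<dots> = (\<Sum>l\<in>S. A i l * g l) - (\<Sum>l\<in>S. A j l * g l)"
    using assms by (simp add: sum_subtractf)
  finally show ?thesis .
qed

lemma sum_mult_unit_difference:
  assumes "finite S" "i \<in> S" "j \<in> S"
  shows "(\<Sum>l\<in>S. a l * (of_bool (l = i) - of_bool (l = j))) = a i - (a j :: real)"
proof -
  have "(\<Sum>l\<in>S. a l * (of_bool (l = i) - of_bool (l = j)))
      = (\<Sum>l\<in>S. (if l = i then a i else 0) - (if l = j then a j else 0))"
    by (intro sum.cong) auto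
  also have "\<dots> = a i - a j" using assms by (simp add: sum_subtractf)
  finally show ?thesis .
qed

text \<open>Along the segment from \<open>f\<close> in direction \<open>e\<^sub>i - e\<^sub>j\<close> the second-order coefficient of the form
  is \<open>A\<^sub>i\<^sub>i + A\<^sub>j\<^sub>j - 2 A\<^sub>i\<^sub>j \<le> 0\<close>, so the form stays below its tangent. One of the two
  orientations of the direction has nonpositive slope at \<open>f\<close>; following it up to the end of the
  segment empties a vertex of the support.\<close>

lemma shift_mass_between_nonadjacent:
  assumes S: "finite S" and sym: "\<And>i j. i \<in> S \<Longrightarrow> j \<in> S \<Longrightarrow> A i j = A j i"
    and f: "f \<in> prob_weights S" and ij: "i \<in> support S f" "j \<in> support S f" "i \<noteq> j"
    and nonadj: "A i i + A j j \<le> 2 * A i j"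
  shows "\<exists>g \<in> prob_weights S. support S g \<subset> support S f \<and> bilinear_form S A g g \<le> bilinear_form S A f f"
proof -
  define grad where "grad k = (\<Sum>l\<in>S. A k l * f l)" for k
  \<comment> \<open>The case in which moving the weight of \<open>j\<close> to \<open>i\<close> is the descent direction; the other case
    exchanges \<open>i\<close> and \<open>j\<close>.\<close>
  have *: ?thesis if ij: "i \<in> support S f" "j \<in> support S f" "i \<noteq> j"
    and nonadj: "A i i + A j j \<le> 2 * A i j" and down: "grad i \<le> grad j" for i j
  proof -
    define d :: "'a \<Rightarrow> real" where "d k = of_bool (k = i) - of_bool (k = j)" for k
    \<comment> \<open>The step length \<open>f j\<close> is the largest that keeps the weights nonnegative.\<close>
    define g where "g k = f k + f j * d k" for k
    have iS: "i \<in> S" and jS: "j \<in> S" using ij by (auto simp: support_def)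
    have pos: "0 \<le> f i" "0 \<le> f j" using f iS jS by (auto simp: prob_weights_def)
    have "sum d S = 0"
      using sum_mult_unit_difference[OF S iS jS, of "\<lambda>_. 1"] by (simp add: d_def)
    then have "sum g S = sum f S"
      by (simp add: g_def sum.distrib flip: sum_distrib_left)
    then have "g \<in> prob_weights S"
      using f pos by (auto simp: prob_weights_def g_def d_def)
    moreover have "support S g \<subset> support S f"
      using ij by (auto simp: support_def g_def d_def of_bool_def split: if_splits)
    moreover have "bilinear_form S A g g \<le> bilinear_form S A f f"
    proof -
      have "bilinear_form S A d f = grad i - grad j"
        unfolding d_def grad_def using S iS jS by (rule bilinear_form_unit_difference)
      then have "f j * bilinear_form S A d f \<le> 0"
        using down pos by (simp add: mult_nonneg_nonpos)
      moreover have "bilinear_form S A d d = A i i - A i j - (A j i - A j j)"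
        unfolding d_def
        by (simp only: bilinear_form_unit_difference[OF S iS jS] sum_mult_unit_difference[OF S iS jS])
      then have "bilinear_form S A d d \<le> 0"
        using nonadj sym[OF iS jS] by simp
      then have "(f j)\<^sup>2 * bilinear_form S A d d \<le> 0"
        by (simp add: mult_nonneg_nonpos)
      ultimately show ?thesis
        unfolding g_def using bilinear_form_add_scale[where A = A, OF sym, of S f "f j" d] by simp
    qed
    ultimately show ?thesis by blast
  qed
  have "A j j + A i i \<le> 2 * A j i"
    using nonadj sym[of i j] ij by (simp add: support_def)
  then show ?thesis
    using *[of i j] *[of j i] ij nonadj linorder_le_cases[of "grad i" "grad j"] by metis
qed

text \<open>Shifting mass strictly shrinks the support, so it can be repeated only finitely often; it
  stops when any two support points satisfy the adjacency condition of the convexity graph.\<close>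

lemma exists_strictly_convex_support:
  assumes S: "finite S" and sym: "\<And>i j. i \<in> S \<Longrightarrow> j \<in> S \<Longrightarrow> A i j = A j i"
    and "f \<in> prob_weights S"
  shows "\<exists>g \<in> prob_weights S. bilinear_form S A g g \<le> bilinear_form S A f f \<and>
    (\<forall>i\<in>support S g. \<forall>j\<in>support S g. i \<noteq> j \<longrightarrow> 2 * A i j < A i i + A j j)"
  using assms(3)
proof (induction "card (support S f)" arbitrary: f rule: less_induct)
  case less
  show ?case
  proof (cases "\<forall>i\<in>support S f. \<forall>j\<in>support S f. i \<noteq> j \<longrightarrow> 2 * A i j < A i i + A j j")
    case False
    then obtain i j where "i \<in> support S f" "j \<in> support S f" "i \<noteq> j" "A i i + A j j \<le> 2 * A i j"
      by (auto simp: not_less)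
    then obtain g where g: "g \<in> prob_weights S" "support S g \<subset> support S f"
      "bilinear_form S A g g \<le> bilinear_form S A f f"
      using shift_mass_between_nonadjacent[OF S, where A = A, OF sym less.prems] by blast
    have "finite (support S f)" using S by (simp add: support_def)
    then have "card (support S g) < card (support S f)"
      using g(2) by (rule psubset_card_mono)
    from less.hyps[OF this g(1)] show ?thesis using g(3) by (meson order_trans)
  qed (use less.prems in blast)
qed

section \<open>The bounds \<open>\<nu>\<close> and \<open>\<ell>\<close> of a matrix\<close>

lemma quadratic_form_conv_bilinear:
  assumes "M \<in> carrier_mat m m"
  shows "vec m f \<bullet> (M *\<^sub>v vec m f) = bilinear_form {..<m} (\<lambda>i j. M $$ (i, j)) f f"
  using assms
  by (auto simp: bilinear_form_def scalar_prod_def lessThan_atLeast0 sum_distrib_left mult.assoc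
      intro!: sum.cong)

lemma vec_in_std_simplex_iff: "vec m f \<in> std_simplex m \<longleftrightarrow> f \<in> prob_weights {..<m}"
  by (auto simp: std_simplex_def prob_weights_def ones_vec_def scalar_prod_def less_eq_vec_def
      lessThan_atLeast0)

lemma nu_le_bilinear:
  assumes "M \<in> sym_mats m" "m > 0" "f \<in> prob_weights {..<m}"
  shows "nu M \<le> bilinear_form {..<m} (\<lambda>i j. M $$ (i, j)) f f"
proof -
  have M: "M \<in> carrier_mat m m" using assms(1) by (simp add: sym_mats_def)
  then have "nu M \<le> vec m f \<bullet> (M *\<^sub>v vec m f)"
    using nu_attained[of M] assms vec_in_std_simplex_iff by auto
  then show ?thesis using quadratic_form_conv_bilinear[OF M] by simp
qed

lemma nu_eq_bilinear:
  assumes "M \<in> sym_mats m" "m > 0"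
  obtains f where "f \<in> prob_weights {..<m}" "nu M = bilinear_form {..<m} (\<lambda>i j. M $$ (i, j)) f f"
proof -
  have M: "M \<in> carrier_mat m m" using assms(1) by (simp add: sym_mats_def)
  then obtain x where x: "x \<in> std_simplex m" "x \<bullet> (M *\<^sub>v x) = nu M"
    using nu_attained[of M] assms by auto
  have "x = vec m (\<lambda>i. x $ i)" using x(1) by (auto simp: std_simplex_def)
  then show ?thesis
    using that[of "\<lambda>i. x $ i"] x quadratic_form_conv_bilinear[OF M] vec_in_std_simplex_iff by metis
qed

lemma sym_mats_index:
  assumes "M \<in> sym_mats m" "i < m" "j < m"
  shows "M $$ (i, j) = M $$ (j, i)"
proof -
  have "transpose_mat M $$ (i, j) = M $$ (j, i)"
    using assms by (intro index_transpose_mat) (auto simp: sym_mats_def)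
  then show ?thesis using assms(1) by (simp add: sym_mats_def)
qed

text \<open>The program for \<open>\<ell>\<close> relaxes the one for \<open>\<nu>\<close>: a point \<open>x\<close> of the simplex gives the feasible
  matrix \<open>x x\<^sup>T\<close> with the same objective value.\<close>

lemma ell_le_nu:
  assumes "M \<in> sym_mats m" "m > 0"
  shows "ell M \<le> nu M"
proof -
  have M: "M \<in> carrier_mat m m" using assms(1) by (simp add: sym_mats_def)
  obtain f where f: "f \<in> prob_weights {..<m}" "nu M = bilinear_form {..<m} (\<lambda>i j. M $$ (i, j)) f f"
    using nu_eq_bilinear[OF assms] .
  define X where "X = mat m m (\<lambda>(i, j). f i * f j)"
  have "0 \<le> v \<bullet> (X *\<^sub>v v)" if "v \<in> carrier_vec m" for v
  proof -
    have "v \<bullet> (X *\<^sub>v v) = (\<Sum>i<m. \<Sum>j<m. (v $ i * f i) * (v $ j * f j))"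
      using that
      by (auto simp: X_def scalar_prod_def lessThan_atLeast0 sum_distrib_left mult_ac
          intro!: sum.cong)
    also have "\<dots> = (\<Sum>i<m. v $ i * f i)\<^sup>2"
      by (simp add: power2_eq_square sum_product)
    finally show ?thesis by simp
  qed
  moreover have "trace_inner (ones_mat m) X = 1"
  proof -
    have "trace_inner (ones_mat m) X = (\<Sum>i<m. \<Sum>j<m. f i * f j)"
      by (simp add: trace_inner_def ones_mat_def X_def)
    then show ?thesis using f(1) by (simp add: prob_weights_def flip: sum_product)
  qed
  moreover have "X \<in> sym_mats m" "0\<^sub>m m m \<le> X"
    using f(1) by (auto simp: sym_mats_def X_def prob_weights_def less_eq_mat_def mult.commute)
  ultimately have "X \<in> dnn_feasible m"
    by (simp add: dnn_feasible_def dnn_cone_def psd_mat_def)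
  then have "ell M \<le> trace_inner M X"
    using ell_attained[of M] assms M by auto
  also have "\<dots> = nu M"
    using M by (simp add: f(2) trace_inner_def bilinear_form_def X_def mult_ac)
  finally show ?thesis .
qed

section \<open>Principal submatrices\<close>

lemma principal_submatrix_carrier:
  assumes "Q \<in> carrier_mat n n" "C \<subseteq> {..<n}"
  shows "principal_submatrix Q C \<in> carrier_mat (card C) (card C)"
proof -
  have "{i. i < n \<and> i \<in> C} = C" using assms(2) by auto
  then show ?thesis using assms(1) by (intro carrier_matI) (simp_all only: dim_submatrix carrier_matD)
qed

lemma principal_submatrix_index:
  assumes "Q \<in> carrier_mat n n" "C \<subseteq> {..<n}" "i < card C" "j < card C"
  shows "principal_submatrix Q C $$ (i, j) = Q $$ (pick C i, pick C j)"
proof -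
  have "{i. i < n \<and> i \<in> C} = C" using assms(2) by auto
  then show ?thesis
    using assms(1,3,4) by (intro submatrix_index) (simp_all only: carrier_matD)
qed

lemma bij_betw_pick:
  assumes "finite C"
  shows "bij_betw (pick C) {..<card C} C"
proof -
  have "inj_on (pick C) {..<card C}"
    by (rule linorder_inj_onI) (use pick_mono[of _ C] in fastforce, auto)
  moreover have "pick C ` {..<card C} \<subseteq> C"
    using pick_in_set by auto
  ultimately show ?thesis
    using assms by (simp add: bij_betw_def card_image card_subset_eq)
qed

lemma principal_submatrix_sym:
  assumes "Q \<in> sym_mats n" "C \<subseteq> {..<n}"
  shows "principal_submatrix Q C \<in> sym_mats (card C)"
proof -
  have Q: "Q \<in> carrier_mat n n" using assms(1) by (simp add: sym_mats_def)
  note bij = bij_betw_pick[OF finite_subset[OF assms(2) finite_lessThan]]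
  have "Q $$ (i, j) = Q $$ (j, i)" if "i < n" "j < n" for i j
    using sym_mats_index[OF assms(1)] that by simp
  moreover have "pick C i < n" if "i < card C" for i
    using bij assms(2) that by (auto simp: bij_betw_def)
  ultimately show ?thesis
    using principal_submatrix_carrier[OF Q assms(2)]
    by (auto simp: sym_mats_def principal_submatrix_index[OF Q assms(2)] intro!: eq_matI)
qed

text \<open>Since \<open>pick C\<close> enumerates \<open>C\<close>, composition with it identifies the weights on \<open>{..<n}\<close>
  supported in \<open>C\<close> with the weights on \<open>{..<card C}\<close>. This lemma and the next transfer form values
  and simplex membership across that identification, in both directions.\<close>

lemma bilinear_form_principal_submatrix:
  assumes "Q \<in> carrier_mat n n" "C \<subseteq> {..<n}" "support {..<n} f \<subseteq> C"
  shows "bilinear_form {..<card C} (\<lambda>i j. principal_submatrix Q C $$ (i, j)) (f \<circ> pick C) (f \<circ> pick C)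
    = bilinear_form {..<n} (\<lambda>i j. Q $$ (i, j)) f f"
proof -
  note bij = bij_betw_pick[OF finite_subset[OF assms(2) finite_lessThan]]
  have "bilinear_form {..<card C} (\<lambda>i j. principal_submatrix Q C $$ (i, j)) (f \<circ> pick C) (f \<circ> pick C)
      = (\<Sum>i<card C. \<Sum>j<card C. f (pick C i) * Q $$ (pick C i, pick C j) * f (pick C j))"
    by (simp add: bilinear_form_def principal_submatrix_index[OF assms(1,2)])
  also have "\<dots> = (\<Sum>i<card C. \<Sum>j\<in>C. f (pick C i) * Q $$ (pick C i, j) * f j)"
    by (intro sum.cong refl sum.reindex_bij_betw[OF bij])
  also have "\<dots> = (\<Sum>i\<in>C. \<Sum>j\<in>C. f i * Q $$ (i, j) * f j)"
    by (rule sum.reindex_bij_betw[OF bij])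
  also have "\<dots> = (\<Sum>i\<in>C. \<Sum>j<n. f i * Q $$ (i, j) * f j)"
    using assms(2,3) by (intro sum.cong sum.mono_neutral_left) (auto simp: support_def)
  also have "\<dots> = bilinear_form {..<n} (\<lambda>i j. Q $$ (i, j)) f f"
    unfolding bilinear_form_def using assms(2,3)
    by (intro sum.mono_neutral_left) (auto simp: support_def intro!: sum.neutral)
  finally show ?thesis .
qed

lemma prob_weights_pick_iff:
  assumes "C \<subseteq> {..<n}" "support {..<n} f \<subseteq> C"
  shows "f \<circ> pick C \<in> prob_weights {..<card C} \<longleftrightarrow> f \<in> prob_weights {..<n}"
proof -
  note bij = bij_betw_pick[OF finite_subset[OF assms(1) finite_lessThan]]
  have "(\<Sum>i<card C. (f \<circ> pick C) i) = sum f C"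
    using sum.reindex_bij_betw[OF bij, of f] by simp
  also have "\<dots> = sum f {..<n}"
    using assms by (intro sum.mono_neutral_left) (auto simp: support_def)
  finally have "(\<Sum>i<card C. (f \<circ> pick C) i) = sum f {..<n}" .
  moreover have "(\<forall>i\<in>{..<card C}. 0 \<le> (f \<circ> pick C) i) \<longleftrightarrow> (\<forall>i\<in>C. 0 \<le> f i)"
    using bij_betw_ball[OF bij, of "\<lambda>i. 0 \<le> f i"] by simp
  moreover have "(\<forall>i\<in>C. 0 \<le> f i) \<longleftrightarrow> (\<forall>i\<in>{..<n}. 0 \<le> f i)"
    using assms by (fastforce simp: support_def)
  ultimately show ?thesis by (simp only: prob_weights_def mem_Collect_eq)
qed

text \<open>Extending a minimizer for the submatrix by zero gives a point of the larger simplex with the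
  same value.\<close>

lemma nu_le_nu_principal_submatrix:
  assumes Q: "Q \<in> sym_mats n" and C: "C \<subseteq> {..<n}" "C \<noteq> {}"
  shows "nu Q \<le> nu (principal_submatrix Q C)"
proof -
  have Qc: "Q \<in> carrier_mat n n" using Q by (simp add: sym_mats_def)
  have fin: "finite C" using C(1) finite_subset by blast
  note bij = bij_betw_pick[OF fin]
  have "card C > 0" using fin C(2) by (simp add: card_gt_0_iff)
  then obtain g where g: "g \<in> prob_weights {..<card C}"
    "nu (principal_submatrix Q C)
      = bilinear_form {..<card C} (\<lambda>i j. principal_submatrix Q C $$ (i, j)) g g"
    using nu_eq_bilinear[OF principal_submatrix_sym[OF Q C(1)]] by blast
  define f where "f i = (if i \<in> C then g (inv_into {..<card C} (pick C) i) else 0)" for i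
  have supp: "support {..<n} f \<subseteq> C" by (auto simp: support_def f_def)
  have fg: "(f \<circ> pick C) i = g i" if "i < card C" for i
    using bij that by (auto simp: f_def bij_betw_def)
  have "f \<circ> pick C \<in> prob_weights {..<card C}"
    using g(1) fg by (simp add: prob_weights_def)
  then have "f \<in> prob_weights {..<n}"
    using prob_weights_pick_iff[OF C(1) supp] by blast
  moreover have "n > 0" using C by auto
  ultimately have "nu Q \<le> bilinear_form {..<n} (\<lambda>i j. Q $$ (i, j)) f f"
    by (intro nu_le_bilinear[OF Q])
  also have "\<dots> = bilinear_form {..<card C} (\<lambda>i j. principal_submatrix Q C $$ (i, j)) g g"
    using bilinear_form_principal_submatrix[OF Qc C(1) supp] fg by (simp add: bilinear_form_def)
  finally show ?thesis using g(2) by simp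
qed

section \<open>Cliques of the convexity graph\<close>

lemma clique_subset_maximal_clique:
  assumes "K \<in> convexity_cliques Q"
  obtains C where "C \<in> maximal_cliques Q" "K \<subseteq> C"
proof -
  have "finite (convexity_cliques Q)"
    by (rule finite_subset[of _ "Pow {..<dim_row Q}"])
      (auto simp: convexity_cliques_def convexity_vertices_def)
  then obtain C where "C \<in> convexity_cliques Q" "K \<subseteq> C"
    "\<forall>D \<in> convexity_cliques Q. C \<subseteq> D \<longrightarrow> C = D"
    using finite_has_maximal2[OF _ assms] by metis
  then have "C \<in> maximal_cliques Q" unfolding maximal_cliques_def by blast
  then show ?thesis using that \<open>K \<subseteq> C\<close> by blast
qed

text \<open>The empty set satisfies \<open>clique\<close>, so nonemptiness, without which \<open>\<nu>(Q\<^sub>C\<^sub>C)\<close> would be an infimum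
  over the empty set, has to come from maximality.\<close>

lemma maximal_clique_nonempty:
  assumes "C \<in> maximal_cliques Q" "dim_row Q > 0"
  shows "C \<noteq> {}"
proof
  assume "C = {}"
  moreover have "{0} \<in> convexity_cliques Q"
    using assms(2) by (simp add: convexity_cliques_def convexity_vertices_def clique_def)
  ultimately show False using assms(1) by (auto simp: maximal_cliques_def)
qed

lemma convexity_edgeI:
  assumes "Q \<in> sym_mats n" "i < n" "j < n" "i \<noteq> j"
    and "2 * Q $$ (i, j) < Q $$ (i, i) + Q $$ (j, j)"
  shows "{i, j} \<in> convexity_edges Q"
proof -
  have Q: "Q \<in> carrier_mat n n" using assms(1) by (simp add: sym_mats_def)
  have "Q $$ (j, i) = Q $$ (i, j)"
    using sym_mats_index[OF assms(1)] assms(2,3) by simp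
  then show ?thesis
  proof (cases "i < j")
    case True
    then show ?thesis using assms Q by (auto simp: convexity_edges_def)
  next
    case False
    have "{j, i} \<in> convexity_edges Q"
      unfolding convexity_edges_def mem_Collect_eq
      using False assms Q \<open>Q $$ (j, i) = Q $$ (i, j)\<close>
      by (intro exI[of _ j] exI[of _ i]) auto
    then show ?thesis by (simp add: insert_commute)
  qed
qed

text \<open>A minimizer whose support is a clique survives restriction to any maximal clique \<open>C\<close> above
  that support, so passing to \<open>Q\<^sub>C\<^sub>C\<close> does not raise the minimum.\<close>

lemma exists_maximal_clique_nu_eq:
  assumes Q: "Q \<in> sym_mats n" and n: "n > 0"
  obtains C where "C \<in> maximal_cliques Q" "nu (principal_submatrix Q C) = nu Q"
proof -
  have Qc: "Q \<in> carrier_mat n n" using Q by (simp add: sym_mats_def)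
  have sym: "Q $$ (i, j) = Q $$ (j, i)" if "i \<in> {..<n}" "j \<in> {..<n}" for i j
    using sym_mats_index[OF Q] that by simp
  obtain f0 where "f0 \<in> prob_weights {..<n}" "nu Q = bilinear_form {..<n} (\<lambda>i j. Q $$ (i, j)) f0 f0"
    using nu_eq_bilinear[OF Q n] .
  then obtain f where f: "f \<in> prob_weights {..<n}"
    "bilinear_form {..<n} (\<lambda>i j. Q $$ (i, j)) f f \<le> nu Q"
    and K: "\<forall>i\<in>support {..<n} f. \<forall>j\<in>support {..<n} f. i \<noteq> j \<longrightarrow>
      2 * Q $$ (i, j) < Q $$ (i, i) + Q $$ (j, j)"
    using exists_strictly_convex_support[OF finite_lessThan, where A = "\<lambda>i j. Q $$ (i, j)", OF sym]
    by metis
  have "clique (support {..<n} f) (convexity_edges Q)"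
    unfolding clique_def using K convexity_edgeI[OF Q] by (simp add: support_def)
  then have "support {..<n} f \<in> convexity_cliques Q"
    using Qc by (auto simp: convexity_cliques_def convexity_vertices_def support_def)
  then obtain C where C: "C \<in> maximal_cliques Q" "support {..<n} f \<subseteq> C"
    by (rule clique_subset_maximal_clique)
  have Cn: "C \<subseteq> {..<n}"
    using C(1) Qc by (auto simp: maximal_cliques_def convexity_cliques_def convexity_vertices_def)
  have Cne: "C \<noteq> {}" using maximal_clique_nonempty[OF C(1)] Qc n by auto
  have "card C > 0" using Cn Cne finite_subset by (auto simp: card_gt_0_iff)
  moreover have "f \<circ> pick C \<in> prob_weights {..<card C}"
    using prob_weights_pick_iff[OF Cn C(2)] f(1) by blast
  ultimately have "nu (principal_submatrix Q C) \<le> bilinear_form {..<n} (\<lambda>i j. Q $$ (i, j)) f f"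
    unfolding bilinear_form_principal_submatrix[OF Qc Cn C(2), symmetric]
    by (intro nu_le_bilinear[OF principal_submatrix_sym[OF Q Cn]])
  then have "nu (principal_submatrix Q C) = nu Q"
    using f(2) nu_le_nu_principal_submatrix[OF Q Cn Cne] by simp
  with C(1) show ?thesis using that by blast
qed

theorem lemma5p2:
  fixes n :: nat and Q :: "real mat"
  assumes "n \<ge> 1" and "Q \<in> sym_mats n"
  shows "(MIN C \<in> maximal_cliques Q. ell (principal_submatrix Q C)) = nu Q
    \<longleftrightarrow> (\<exists>Cstar \<in> maximal_cliques Q.
           principal_submatrix Q Cstar \<in> exact_mats (card Cstar) \<and>
           (MIN C \<in> maximal_cliques Q. ell (principal_submatrix Q C))
             = ell (principal_submatrix Q Cstar))"
    (is "?m = _ \<longleftrightarrow> _")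
proof -
  have Qc: "dim_row Q = n" using assms(2) by (auto simp: sym_mats_def)
  have n: "n > 0" using assms(1) by simp
  have clique_subset: "C \<subseteq> {..<n}" and clique_nonempty: "C \<noteq> {}" if "C \<in> maximal_cliques Q" for C
    using that Qc n maximal_clique_nonempty[OF that]
    by (auto simp: maximal_cliques_def convexity_cliques_def convexity_vertices_def)
  have min_le: "?m \<le> ell (principal_submatrix Q C)" if "C \<in> maximal_cliques Q" for C
    using that finite_maximal_cliques by (intro Min_le) auto
  obtain C0 where C0: "C0 \<in> maximal_cliques Q" "nu (principal_submatrix Q C0) = nu Q"
    using exists_maximal_clique_nu_eq[OF assms(2) n] .
  note sub0 = principal_submatrix_sym[OF assms(2) clique_subset[OF C0(1)]]
  have "card C0 > 0"
    using clique_subset[OF C0(1)] clique_nonempty[OF C0(1)] finite_subset by (auto simp: card_gt_0_iff)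
  then have ell0: "ell (principal_submatrix Q C0) \<le> nu Q"
    using ell_le_nu[OF sub0] C0(2) by simp
  show ?thesis
  proof
    assume "?m = nu Q"
    \<comment> \<open>\<open>nu Q = ?m \<le> ell (principal_submatrix Q C0) \<le> nu Q\<close>, so \<open>C0\<close> is exact and attains the minimum.\<close>
    then have "ell (principal_submatrix Q C0) = nu Q"
      using ell0 min_le[OF C0(1)] by simp
    then show "\<exists>Cstar \<in> maximal_cliques Q.
        principal_submatrix Q Cstar \<in> exact_mats (card Cstar) \<and>
        ?m = ell (principal_submatrix Q Cstar)"
      using \<open>?m = nu Q\<close> C0 sub0 by (intro bexI[of _ C0]) (auto simp: exact_mats_def)
  next
    assume "\<exists>Cstar \<in> maximal_cliques Q.
        principal_submatrix Q Cstar \<in> exact_mats (card Cstar) \<and>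
        ?m = ell (principal_submatrix Q Cstar)"
    then obtain D where D: "D \<in> maximal_cliques Q" "?m = nu (principal_submatrix Q D)"
      by (auto simp: exact_mats_def)
    then have "nu Q \<le> ?m"
      using nu_le_nu_principal_submatrix[OF assms(2) clique_subset clique_nonempty] by metis
    moreover have "?m \<le> nu Q" using ell0 min_le[OF C0(1)] by simp
    ultimately show "?m = nu Q" by simp
  qed
qed

end
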